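(* Let $G$ be a finite simple circular-arc graph with maximum degree $\Delta$. Then $\mathrm{cub}(G)\le 2\Delta+1$, where $\mathrm{cub}(G)$ denotes the cubicity of $G$.
   Context: All graphs are simple, finite and undirected. Cubicity: a $k$-cube is a Cartesian product $R_1\times\cdots\times R_k$ where each $R_i$ is a closed interval of the form $[a_i,a_i+1]$ on the real line. The cubicity $\mathrm{cub}(G)$ is the minimum $k$ such that each vertex of $G$ can be mapped to a $k$-cube so that two distinct vertices are adjacent in $G$ if and only if their $k$-cubes have non-empty intersection. A circular-arc graph is the intersection graph of a family of arcs on a circle: each vertex can be assigned a closed arc of the circle so that two distinct vertices are adjacent if and only if their arcs intersect. *)

theory Defs
  imports Complex_Main "HOL-Library.FuncSet" "Graph_Theory.Digraph"
begin

text \<open>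
  A finite simple undirected graph is a \<^locale>\<open>graph\<close>: a finite digraph without loops
  and parallel arcs whose arc relation is symmetric.  An undirected edge is thus a pair of
  opposite arcs, and the degree of a vertex is its \<^const>\<open>out_degree\<close>.
  The graph without vertices gets maximum degree 0.
\<close>

definition max_degree :: "('a, 'b) pre_digraph \<Rightarrow> nat" where
  "max_degree G = Max (insert 0 (out_degree G ` verts G))"

definition intersection_rep :: "('a, 'b) pre_digraph \<Rightarrow> ('a \<Rightarrow> 'c set) \<Rightarrow> bool" where
  "intersection_rep G f \<longleftrightarrow>
     (\<forall>u\<in>verts G. \<forall>v\<in>verts G. u \<noteq> v \<longrightarrow> (u \<rightarrow>\<^bsub>G\<^esub> v \<longleftrightarrow> f u \<inter> f v \<noteq> {}))"

text \<open>
  Points of \<open>\<real>\<^sup>k\<close> are extensional functions on \<open>{..<k}\<close>.  For \<open>k = 0\<close> the only cube is a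
  single point, so complete graphs have cubicity 0.
\<close>

definition is_cube :: "nat \<Rightarrow> (nat \<Rightarrow> real) set \<Rightarrow> bool" where
  "is_cube k C \<longleftrightarrow> (\<exists>a. C = (\<Pi>\<^sub>E i\<in>{..<k}. {a i..a i + 1}))"

definition cubicity :: "('a, 'b) pre_digraph \<Rightarrow> nat" where
  "cubicity G = (LEAST k. \<exists>f. (\<forall>v\<in>verts G. is_cube k (f v)) \<and> intersection_rep G f)"

text \<open>
  Closed arcs of the unit circle; single points (\<open>a = b\<close>) and the whole circle
  (\<open>b \<ge> a + 2 * pi\<close>) are included.
\<close>

definition is_closed_arc :: "complex set \<Rightarrow> bool" where
  "is_closed_arc A \<longleftrightarrow> (\<exists>a b. a \<le> b \<and> A = cis ` {a..b})"

definition circular_arc_graph :: "('a, 'b) pre_digraph \<Rightarrow> bool" where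
  "circular_arc_graph G \<longleftrightarrow>
     (\<exists>f. (\<forall>v\<in>verts G. is_closed_arc (f v)) \<and> intersection_rep G f)"

end

theory Submission
  imports Defs
begin

text \<open>
  Sort the vertices by the starting points of their arcs.  If two arcs meet, one of them contains the
  starting point of the other and hence all starting points in between, so adjacent vertices are at
  cyclic distance at most \<open>\<Delta>\<close>.  Folding the cycle flat gives a linear order of bandwidth
  at most \<open>2 * \<Delta>\<close>.

  A graph of bandwidth \<open>b\<close> has cubicity at most \<open>b + 1\<close>.  One coordinate, roughly \<open>x / b\<close>,
  separates the non-adjacent pairs at distance at least \<open>b\<close> in the order.  For each residue class
  modulo \<open>b\<close> one further coordinate separates every \<open>x\<close> in that class from its non-neighbours in
  \<open>{x<..<x + b}\<close>.
\<close>

section \<open>Cube representations as families of real coordinates\<close>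

lemma PiE_unit_cubes_Int_nonempty_iff:
  fixes a c :: "nat \<Rightarrow> real"
  shows "(\<Pi>\<^sub>E i\<in>{..<k}. {a i..a i + 1}) \<inter> (\<Pi>\<^sub>E i\<in>{..<k}. {c i..c i + 1}) \<noteq> {} \<longleftrightarrow>
    (\<forall>i<k. \<bar>a i - c i\<bar> \<le> 1)"
proof -
  have "{a i..a i + 1} \<inter> {c i..c i + 1} = {max (a i) (c i)..min (a i + 1) (c i + 1)}" for i
    by auto
  then have "{a i..a i + 1} \<inter> {c i..c i + 1} \<noteq> {} \<longleftrightarrow> \<bar>a i - c i\<bar> \<le> 1" for i
    by (auto simp: max_def min_def abs_le_iff)
  then show ?thesis
    by (simp add: PiE_Int PiE_eq_empty_iff Ball_def)
qed

text \<open>From here on no cubes are needed: a representation is \<open>k\<close> real functions,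
  where \<open>F i v\<close> is the left end of the \<open>i\<close>-th side of the cube of
  \<open>v\<close>.\<close>

lemma cubicity_le:
  fixes F :: "nat \<Rightarrow> 'a \<Rightarrow> real"
  assumes "\<And>u v. \<lbrakk>u \<in> verts G; v \<in> verts G; u \<noteq> v\<rbrakk> \<Longrightarrow>
    u \<rightarrow>\<^bsub>G\<^esub> v \<longleftrightarrow> (\<forall>i<k. \<bar>F i u - F i v\<bar> \<le> 1)"
  shows "cubicity G \<le> k"
  unfolding cubicity_def
proof (rule Least_le, intro exI conjI)
  let ?f = "\<lambda>v. \<Pi>\<^sub>E i\<in>{..<k}. {F i v..F i v + 1}"
  show "\<forall>v\<in>verts G. is_cube k (?f v)"
    unfolding is_cube_def by (intro ballI exI[of _ "\<lambda>i. F i v" for v]) (rule refl)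
  show "intersection_rep G ?f"
    unfolding intersection_rep_def PiE_unit_cubes_Int_nonempty_iff
    by (intro ballI impI assms)
qed

section \<open>Coordinates for graphs of bounded bandwidth\<close>

text \<open>Walks down \<open>x\<close>, \<open>x - b\<close>, \<open>x - 2 * b\<close>, ... and
  counts the consecutive pairs that are not adjacent. The test \<open>b = 0\<close> is there for
  termination.\<close>

fun missing_links :: "(nat \<Rightarrow> nat \<Rightarrow> bool) \<Rightarrow> nat \<Rightarrow> nat \<Rightarrow> nat" where
  "missing_links A b x =
    (if b = 0 \<or> x < b then 0 else missing_links A b (x - b) + of_bool (\<not> A (x - b) x))"

declare missing_links.simps [simp del]

lemma missing_links_add:
  "0 < b \<Longrightarrow> missing_links A b (x + b) = missing_links A b x + of_bool (\<not> A x (x + b))"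
  by (subst missing_links.simps) simp

lemma missing_links_le: "missing_links A b x \<le> x"
proof (induction A b x rule: missing_links.induct)
  case (1 A b x)
  then show ?case
    by (subst missing_links.simps) (auto simp: of_bool_def)
qed

text \<open>
  Positions at distance exactly \<open>b\<close> would get difference exactly 1; the \<open>\<epsilon>\<close>-term pushes the
  non-adjacent ones apart.
\<close>

definition long_coord :: "(nat \<Rightarrow> nat \<Rightarrow> bool) \<Rightarrow> nat \<Rightarrow> real \<Rightarrow> nat \<Rightarrow> real" where
  "long_coord A b \<epsilon> x = real x / real b + \<epsilon> * real (missing_links A b x)"

text \<open>
  Positions congruent to \<open>i\<close> modulo \<open>b\<close> are centres.  Here \<open>x - m\<close> is the last centre up to \<open>x\<close>, and
  all other positions are placed at distance 1, or slightly more, to the right of their centre.  The drift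
  \<open>\<epsilon> * t\<close> keeps them within distance 1 of the later centres.  For \<open>x < i\<close> there is no such centre:
  \<open>t\<close> is 0 and \<open>x - m\<close> truncates, but the resulting value is harmless.
\<close>

definition short_coord :: "(nat \<Rightarrow> nat \<Rightarrow> bool) \<Rightarrow> nat \<Rightarrow> real \<Rightarrow> nat \<Rightarrow> nat \<Rightarrow> real" where
  "short_coord A b \<epsilon> i x =
    (let t = (x + b - i) div b; m = (x + b - i) mod b in
      if m = 0 then \<epsilon> * real t else 1 + \<epsilon> * real (t + of_bool (\<not> A (x - m) x)))"

text \<open>The choice of \<epsilon> keeps every \<epsilon>-term below \<open>1 / b\<close>, the
  step width of \<open>x / b\<close>. Hence these terms matter only at distance exactly
  \<open>b\<close>, where they differ by \<epsilon> or 0 according to whether the link is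
  missing.\<close>

lemma long_coord_close_iff:
  fixes \<epsilon> :: real
  assumes "0 < b" "x < y" "y < N" "0 < \<epsilon>" "\<epsilon> * real (b * (N + 1)) = 1"
  shows "\<bar>long_coord A b \<epsilon> x - long_coord A b \<epsilon> y\<bar> \<le> 1 \<longleftrightarrow> y < x + b \<or> y = x + b \<and> A x y"
proof -
  have small: "\<epsilon> * real (missing_links A b z) < 1 / real b" if "z < N" for z
  proof -
    have "real (missing_links A b z) < N + 1"
      using missing_links_le[of A b z] that by linarith
    then have "\<epsilon> * real (missing_links A b z) < \<epsilon> * real (N + 1)"
      using assms(4) by simp
    also have "\<dots> = 1 / real b"
      using assms(1,5) by (simp add: field_simps)
    finally show ?thesis .
  qed
  have nonneg: "0 \<le> \<epsilon> * real (missing_links A b z)" for z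
    using assms(4) by simp
  let ?d = "long_coord A b \<epsilon> y - long_coord A b \<epsilon> x"
  have d: "?d = (real y - real x) / real b + \<epsilon> * real (missing_links A b y) - \<epsilon> * real (missing_links A b x)"
    by (simp add: long_coord_def diff_divide_distrib)
  have "1 / real b \<le> (real y - real x) / real b"
    using assms(2) by (intro divide_right_mono) auto
  then have pos: "0 < ?d"
    using small[of x] nonneg[of y] assms(2,3) d by simp
  consider "y < x + b" | "y = x + b" | "x + b < y"
    by linarith
  then have "?d \<le> 1 \<longleftrightarrow> y < x + b \<or> y = x + b \<and> A x y"
  proof cases
    case 1
    then have "real y - real x \<le> real b - 1"
      by linarith
    then have "(real y - real x) / real b \<le> (real b - 1) / real b"
      by (intro divide_right_mono) auto
    also have "\<dots> = 1 - 1 / real b"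
      using assms(1) by (simp add: field_simps)
    finally show ?thesis
      using 1 small[of y] nonneg[of x] assms(3) d by simp
  next
    case 2
    then have "?d = 1 + \<epsilon> * of_bool (\<not> A x y)"
      using assms(1) missing_links_add[of b A x] unfolding d by (simp add: algebra_simps)
    then show ?thesis
      using 2 assms(4) by simp
  next
    case 3
    then have "real b + 1 \<le> real y - real x"
      by linarith
    then have "(real b + 1) / real b \<le> (real y - real x) / real b"
      by (intro divide_right_mono) auto
    moreover have "(real b + 1) / real b = 1 + 1 / real b"
      using assms(1) by (simp add: field_simps)
    ultimately show ?thesis
      using 3 small[of x] nonneg[of y] assms(2,3) d by simp
  qed
  then show ?thesis
    using pos by simp
qed

text \<open>Centres have values in \<open>[0, 1]\<close> and the other positions in
  \<open>[1, 2]\<close>, so only mixed pairs need care. There the adjacency of \<open>x\<close> and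
  \<open>y\<close>, or the drift, compensates the \<epsilon>-terms.\<close>

lemma short_coord_close:
  fixes \<epsilon> :: real
  assumes "i < b" "x < y" "y < N" "0 < \<epsilon>" "\<epsilon> * real (b * (N + 1)) = 1" "A x y" "y \<le> x + b"
  shows "\<bar>short_coord A b \<epsilon> i x - short_coord A b \<epsilon> i y\<bar> \<le> 1"
proof -
  define t where "t z = (z + b - i) div b" for z
  define m where "m z = (z + b - i) mod b" for z
  define e where "e z = (of_bool (\<not> A (z - m z) z) :: nat)" for z
  have eq: "short_coord A b \<epsilon> i z = (if m z = 0 then \<epsilon> * real (t z) else 1 + \<epsilon> * real (t z + e z))" for z
    by (simp add: short_coord_def Let_def t_def m_def e_def)
  have e: "e z \<le> 1" for z
    by (simp add: e_def)
  have dec: "z + b - i = b * t z + m z" for z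
    by (simp add: t_def m_def)
  have m: "m z < b" for z
    using assms(1) by (simp add: m_def)
  have t: "t z \<le> N" if "z < N" for z
  proof -
    have "b * t z \<le> z + b"
      using dec[of z] by linarith
    also have "\<dots> \<le> b * (z + 1)"
      using assms(1) by (simp add: algebra_simps)
    finally have "t z \<le> z + 1"
      using assms(1) by (subst (asm) mult_le_cancel1) auto
    then show ?thesis
      using that by simp
  qed
  \<comment> \<open>As \<open>t z + e z\<close> is at most \<open>N + 1\<close>, this bounds all
    \<epsilon>-terms by 1.\<close>
  have "\<epsilon> * real (N + 1) * 1 \<le> \<epsilon> * real (N + 1) * real b"
    using assms(1,4) by (intro mult_left_mono) auto
  then have eN: "\<epsilon> * real (N + 1) \<le> 1"
    using assms(5) by (simp add: algebra_simps)
  have small: "0 \<le> \<epsilon> * real k \<and> \<epsilon> * real k \<le> 1" if "k \<le> N + 1" for k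
  proof -
    have "\<epsilon> * real k \<le> \<epsilon> * real (N + 1)"
      using assms(4) that by (intro mult_left_mono) auto
    then show ?thesis
      using eN assms(4) by (meson mult_nonneg_nonneg of_nat_0_le_iff order.strict_implies_order order.trans)
  qed
  have s: "0 \<le> \<epsilon> * real (t z)" "\<epsilon> * real (t z) \<le> 1" "0 \<le> \<epsilon> * real (t z + e z)" "\<epsilon> * real (t z + e z) \<le> 1" if "z < N" for z
    using small[of "t z"] small[of "t z + e z"] t[OF that] e[of z] by auto
  note sx = s[of x] and sy = s[of y]
  have xN: "x < N"
    using assms by simp
  consider "m x = 0" "m y = 0" | "m x = 0" "m y \<noteq> 0" | "m x \<noteq> 0" "m y = 0" | "m x \<noteq> 0" "m y \<noteq> 0"
    by blast
  then show ?thesis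
  proof cases
    case 1
    then show ?thesis
      using sx sy xN assms(3) by (simp add: eq abs_le_iff)
  next
    case 2
    \<comment> \<open>The only centre within distance \<open>b\<close> after \<open>x\<close> is
      \<open>x + b\<close>. Hence \<open>x\<close> is still the last centre before \<open>y\<close>,
      and \<open>A x y\<close> makes \<open>e y\<close> vanish: the difference is exactly 1.\<close>
    have yx: "y + b - i = (x + b - i) + (y - x)"
      using assms(1,2) by simp
    have "y - x \<noteq> b"
      using 2 yx by (auto simp: m_def)
    then have "y - x < b"
      using assms(7) by simp
    moreover have "y + b - i = b * t x + (y - x)"
      using yx dec[of x] 2 by simp
    ultimately have "t y = t x" "m y = y - x"
      by (simp_all add: t_def m_def)
    moreover from this have "e y = 0"
      using assms(2,6) by (simp add: e_def)
    ultimately show ?thesis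
      using 2 by (simp add: eq)
  next
    case 3
    \<comment> \<open>The centre \<open>y\<close> starts a later block, so its drift has grown by at
      least the \<epsilon> that \<open>e x\<close> may add.\<close>
    have "b * t x < b * t y"
      using dec[of x] dec[of y] 3 assms(1,2) by linarith
    then have "t x + e x \<le> t y"
      using e[of x] by simp
    then have "\<epsilon> * real (t x + e x) \<le> \<epsilon> * real (t y)"
      using assms(4) by (intro mult_left_mono) auto
    then show ?thesis
      using 3 sx sy xN assms(3) by (simp add: eq abs_le_iff)
  next
    case 4
    then show ?thesis
      using sx sy xN assms(3) by (simp add: eq abs_le_iff)
  qed
qed

text \<open>For the residue of \<open>x\<close>, the position \<open>x\<close> is itself a centre
  and the last one up to \<open>y\<close>. Both carry the same drift, so the missing adjacency gives
  difference \<open>1 + \<epsilon>\<close>.\<close>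

lemma short_coord_far:
  fixes \<epsilon> :: real
  assumes "x < y" "y < x + b" "0 < \<epsilon>" "\<not> A x y"
  shows "1 < \<bar>short_coord A b \<epsilon> (x mod b) x - short_coord A b \<epsilon> (x mod b) y\<bar>"
proof -
  \<comment> \<open>The summand 1 comes from the shift by \<open>b\<close> in
    \<open>short_coord\<close>.\<close>
  define t where "t = x div b + 1"
  have "x mod b + b * t = x + b"
    by (simp add: t_def algebra_simps)
  then have "x + b - x mod b = b * t" "y + b - x mod b = b * t + (y - x)"
    using assms(1) by linarith+
  moreover have "0 < b" "y - x < b"
    using assms(1,2) by auto
  ultimately have "(x + b - x mod b) div b = t" "(x + b - x mod b) mod b = 0"
    "(y + b - x mod b) div b = t" "(y + b - x mod b) mod b = y - x"
    by simp_all
  then show ?thesis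
    using assms by (simp add: short_coord_def Let_def algebra_simps)
qed

lemma bandwidth_coords:
  fixes A :: "nat \<Rightarrow> nat \<Rightarrow> bool"
  assumes "\<And>x y. A x y \<Longrightarrow> y \<le> x + b"
  obtains F :: "nat \<Rightarrow> nat \<Rightarrow> real" where
    "\<And>x y. x < y \<Longrightarrow> y < N \<Longrightarrow> A x y \<longleftrightarrow> (\<forall>i<b + 1. \<bar>F i x - F i y\<bar> \<le> 1)"
proof (cases "b = 0")
  case True
  \<comment> \<open>With \<open>b = 0\<close> no two positions are adjacent, and doubling puts them
    more than 1 apart.\<close>
  have "\<not> A x y" if "x < y" for x y
    using assms[of x y] that True by auto
  then have "x < y \<Longrightarrow> A x y \<longleftrightarrow> (\<forall>i<b + 1. \<bar>2 * real x - 2 * real y\<bar> \<le> 1)" for x y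
    using True by auto
  then show thesis
    by (intro that[of "\<lambda>i x. 2 * real x"])
next
  case False
  define \<epsilon> where "\<epsilon> = 1 / real (b * (N + 1))"
  have "0 < real (b * (N + 1))"
    unfolding of_nat_0_less_iff using False by simp
  then have \<epsilon>: "0 < \<epsilon>" "\<epsilon> * real (b * (N + 1)) = 1"
    unfolding \<epsilon>_def by (simp_all del: of_nat_mult)
  define F where "F i = (if i = b then long_coord A b \<epsilon> else short_coord A b \<epsilon> i)" for i
  have "A x y \<longleftrightarrow> (\<forall>i<b + 1. \<bar>F i x - F i y\<bar> \<le> 1)" if xy: "x < y" "y < N" for x y
  proof
    assume A: "A x y"
    show "\<forall>i<b + 1. \<bar>F i x - F i y\<bar> \<le> 1"
    proof (intro allI impI)
      fix i assume "i < b + 1"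
      then show "\<bar>F i x - F i y\<bar> \<le> 1"
        using long_coord_close_iff[of b x y N \<epsilon> A] short_coord_close[of i b x y N \<epsilon> A]
          False xy \<epsilon> A assms[OF A] by (auto simp: F_def)
    qed
  next
    assume close: "\<forall>i<b + 1. \<bar>F i x - F i y\<bar> \<le> 1"
    then have "\<bar>F b x - F b y\<bar> \<le> 1"
      by simp
    then have "y < x + b \<or> A x y"
      using long_coord_close_iff[of b x y N \<epsilon> A] False xy \<epsilon> by (auto simp: F_def)
    moreover have "A x y" if "y < x + b"
    proof (rule ccontr)
      have "x mod b < b"
        using False by simp
      then have "\<bar>F (x mod b) x - F (x mod b) y\<bar> \<le> 1"
        using close by simp
      moreover assume "\<not> A x y"
      ultimately show False
        using short_coord_far[of x y b \<epsilon> A] \<open>x mod b < b\<close> that xy \<epsilon> by (simp add: F_def)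
    qed
    ultimately show "A x y"
      by blast
  qed
  then show thesis
    by (rule that)
qed

lemma cubicity_le_bandwidth:
  fixes p :: "'a \<Rightarrow> nat"
  assumes "graph G" and inj: "inj_on p (verts G)"
    and bw: "\<And>u v. u \<rightarrow>\<^bsub>G\<^esub> v \<Longrightarrow> p v \<le> p u + b"
  shows "cubicity G \<le> b + 1"
proof -
  interpret graph G by fact
  \<comment> \<open>Adjacency carried over to positions; injectivity of \<open>p\<close> makes this
    faithful on vertices.\<close>
  define A where "A x y \<longleftrightarrow> (\<exists>u v. u \<rightarrow>\<^bsub>G\<^esub> v \<and> p u = x \<and> p v = y)" for x y
  have A: "A (p u) (p v) \<longleftrightarrow> u \<rightarrow>\<^bsub>G\<^esub> v" if "u \<in> verts G" "v \<in> verts G" for u v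
    unfolding A_def using that inj by (metis adj_in_verts(1,2) inj_onD)
  define N where "N = Suc (Max (p ` verts G))"
  have N: "p v < N" if "v \<in> verts G" for v
    using that by (simp add: N_def less_Suc_eq_le)
  have "A x y \<Longrightarrow> y \<le> x + b" for x y
    unfolding A_def using bw by blast
  then obtain F :: "nat \<Rightarrow> nat \<Rightarrow> real" where
    F: "\<And>x y. x < y \<Longrightarrow> y < N \<Longrightarrow> A x y \<longleftrightarrow> (\<forall>i<b + 1. \<bar>F i x - F i y\<bar> \<le> 1)"
    using bandwidth_coords[of A b N] by blast
  show ?thesis
  proof (rule cubicity_le)
    fix u v assume uv: "u \<in> verts G" "v \<in> verts G" "u \<noteq> v"
    show "u \<rightarrow>\<^bsub>G\<^esub> v \<longleftrightarrow> (\<forall>i<b + 1. \<bar>F i (p u) - F i (p v)\<bar> \<le> 1)"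
    proof (cases "p u < p v")
      case True
      then show ?thesis
        using F[of "p u" "p v"] N A uv by simp
    next
      case False
      then have "p v < p u"
        using inj uv by (metis inj_onD linorder_neqE_nat)
      moreover have "u \<rightarrow>\<^bsub>G\<^esub> v \<longleftrightarrow> v \<rightarrow>\<^bsub>G\<^esub> u"
        using sym_arcs by (auto simp: symmetric_def dest: symD)
      ultimately show ?thesis
        using F[of "p v" "p u"] N A uv by (simp add: abs_minus_commute)
    qed
  qed
qed

section \<open>Sorting the vertices and folding a cycle\<close>

lemma ex_monotone_enumeration:
  fixes a :: "'a \<Rightarrow> real"
  assumes "finite V"
  obtains p where "bij_betw p V {..<card V}"
    "\<And>u v. \<lbrakk>u \<in> V; v \<in> V; p u \<le> p v\<rbrakk> \<Longrightarrow> a u \<le> a v"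
proof -
  obtain xs where xs: "set xs = V" "distinct xs"
    using finite_distinct_list[OF assms] by blast
  define ys where "ys = sort_key a xs"
  have ys: "set ys = V" "distinct ys" "length ys = card V" "sorted (map a ys)"
    using xs by (simp_all add: ys_def flip: distinct_card)
  have bij: "bij_betw ((!) ys) {..<card V} V"
    using ys by (intro bij_betw_nth) auto
  define p where "p = inv_into {..<card V} ((!) ys)"
  have p: "bij_betw p V {..<card V}"
    unfolding p_def by (rule bij_betw_inv_into[OF bij])
  have p_nth: "ys ! p v = v" "p v < card V" if "v \<in> V" for v
    using bij_betw_inv_into_right[OF bij that] bij_betwE[OF p] that by (auto simp: p_def)
  show thesis
  proof (rule that[OF p])
    fix u v assume "u \<in> V" "v \<in> V" "p u \<le> p v"
    then show "a u \<le> a v"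
      using sorted_nth_mono[OF ys(4), of "p u" "p v"] p_nth ys(3) by simp
  qed
qed

text \<open>Reorders \<open>0, \<dots>, n - 1\<close> as \<open>0, n - 1, 1, n - 2, \<dots>\<close>.\<close>

definition fold_cycle :: "nat \<Rightarrow> nat \<Rightarrow> nat" where
  "fold_cycle n i = (if 2 * i < n then 2 * i else 2 * (n - 1 - i) + 1)"

text \<open>Naming \<open>n - 1 - i\<close> removes the truncated subtraction, which leaves linear
  arithmetic.\<close>

lemma fold_cycle_eqI:
  "n = i + k + 1 \<Longrightarrow> fold_cycle n i = (if i \<le> k then 2 * i else 2 * k + 1)"
  by (simp add: fold_cycle_def)

lemma fold_cycle_cases:
  assumes "i < n" "j < n"
  obtains k l where "n = i + k + 1" "n = j + l + 1"
    "fold_cycle n i = (if i \<le> k then 2 * i else 2 * k + 1)"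
    "fold_cycle n j = (if j \<le> l then 2 * j else 2 * l + 1)"
proof (rule that)
  show eq: "n = i + (n - 1 - i) + 1" "n = j + (n - 1 - j) + 1"
    using assms by simp_all
  show "fold_cycle n i = (if i \<le> n - 1 - i then 2 * i else 2 * (n - 1 - i) + 1)"
    "fold_cycle n j = (if j \<le> n - 1 - j then 2 * j else 2 * (n - 1 - j) + 1)"
    by (rule fold_cycle_eqI[OF eq(1)], rule fold_cycle_eqI[OF eq(2)])
qed

lemma inj_on_fold_cycle: "inj_on (fold_cycle n) {..<n}"
proof (rule inj_on_inverseI)
  show "(\<lambda>k. if even k then k div 2 else n - 1 - k div 2) (fold_cycle n i) = i" if "i \<in> {..<n}" for i
    using that by (auto simp: fold_cycle_def)
qed

text \<open>One step along the cycle, including the step from \<open>n - 1\<close> to 0, moves the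
  folded position by at most 2. The last two disjuncts of the hypothesis measure the distance across
  0; when their subtraction truncates, they say \<open>n \<le> d\<close>.\<close>

lemma fold_cycle_le:
  assumes "i < n" "j < n" "j \<le> i + d \<and> i \<le> j + d \<or> n \<le> d + (i - j) \<or> n \<le> d + (j - i)"
  shows "fold_cycle n j \<le> fold_cycle n i + 2 * d"
proof -
  obtain k l where kl: "n = i + k + 1" "n = j + l + 1"
    "fold_cycle n i = (if i \<le> k then 2 * i else 2 * k + 1)"
    "fold_cycle n j = (if j \<le> l then 2 * j else 2 * l + 1)"
    using fold_cycle_cases[OF assms(1,2)] by metis
  consider "j \<le> i + d" "i \<le> j + d" | "n + j \<le> d + i" | "n + i \<le> d + j" | "n \<le> d"
    using assms(3) by linarith
  then show ?thesis
    using kl by cases (auto split: if_splits)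
qed

section \<open>Arcs on the circle and the cyclic order\<close>

text \<open>All members of \<open>S\<close> other than \<open>u\<close> are heads of arcs leaving
  \<open>u\<close>; the successor pays for \<open>u\<close> itself.\<close>

lemma card_le_max_degree:
  assumes "graph G" "u \<in> verts G" and nbr: "\<And>w. w \<in> S \<Longrightarrow> w \<noteq> u \<Longrightarrow> u \<rightarrow>\<^bsub>G\<^esub> w"
  shows "card S \<le> Suc (max_degree G)"
proof -
  interpret graph G by fact
  have "S - {u} \<subseteq> head G ` out_arcs G u"
    using nbr by (force simp: out_arcs_def arcs_ends_def arc_to_ends_def)
  then have "card (S - {u}) \<le> card (head G ` out_arcs G u)"
    by (intro card_mono) auto
  also have "\<dots> \<le> out_degree G u"
    unfolding out_degree_def by (intro card_image_le) auto
  also have "\<dots> \<le> max_degree G"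
    unfolding max_degree_def using assms(2) by (intro Max_ge) auto
  finally show ?thesis
    by (metis card_Diff_singleton le_diff_conv Suc_eq_plus1 le_SucI Diff_empty Diff_insert0)
qed

lemma closed_arc_normalized:
  assumes "is_closed_arc C"
  obtains a b where "0 \<le> a" "a < 2 * pi" "a \<le> b" "C = cis ` {a..b}"
proof -
  obtain a b where ab: "a \<le> b" "C = cis ` {a..b}"
    using assms by (auto simp: is_closed_arc_def)
  define k where "k = \<lfloor>a / (2 * pi)\<rfloor>"
  define s where "s = 2 * pi * of_int k"
  have "of_int k \<le> a / (2 * pi)" "a / (2 * pi) < of_int k + 1"
    unfolding k_def by linarith+
  then have "0 \<le> a - s" "a - s < 2 * pi"
    by (simp_all add: s_def field_simps)
  moreover have "cis (x - s) = cis x" for x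
    by (simp add: s_def flip: cis_divide)
  then have "cis ` {a..b} = cis ` ((\<lambda>x. x - s) ` {a..b})"
    by (simp only: image_image)
  then have "C = cis ` {a - s..b - s}"
    using ab by simp
  ultimately show thesis
    using ab by (intro that[of "a - s" "b - s"]) auto
qed

text \<open>Two angles of a common point differ by \<open>2 * pi * k\<close>, and the sign of
  \<open>k\<close> tells which arc runs through the start of the other. As starts lie in
  \<open>[0, 2 * pi)\<close>, a start is met either directly or one turn later.\<close>

lemma intersecting_arcs:
  assumes "0 \<le> a" "a < 2 * pi" "0 \<le> c" "c < 2 * pi"
    and "cis ` {a..b} \<inter> cis ` {c..d} \<noteq> {}"
  shows "c \<in> {a..b} \<or> c + 2 * pi \<le> b \<or> a \<in> {c..d} \<or> a + 2 * pi \<le> d"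
proof -
  obtain s t where st: "s \<in> {a..b}" "t \<in> {c..d}" "cis s = cis t"
    using assms(5) by blast
  then have "sin s = sin t \<and> cos s = cos t"
    by (simp add: complex_eq_iff)
  then obtain k :: int where k: "s = t + 2 * pi * of_int k"
    unfolding sin_cos_eq_iff by blast
  consider "k = 0" | "1 \<le> k" | "k \<le> -1"
    by linarith
  then show ?thesis
  proof cases
    case 1
    then show ?thesis
      using st k by auto
  next
    case 2
    then have "2 * pi * 1 \<le> 2 * pi * of_int k"
      by (intro mult_left_mono) auto
    then have "c + 2 * pi \<le> b"
      using st k unfolding atLeastAtMost_iff by linarith
    then show ?thesis
      by simp
  next
    case 3
    then have "2 * pi * of_int k \<le> 2 * pi * (-1)"
      by (intro mult_left_mono) auto
    then have "a + 2 * pi \<le> d"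
      using st k unfolding atLeastAtMost_iff by linarith
    then show ?thesis
      by simp
  qed
qed

lemma circular_arc_cyclic_order:
  assumes "graph G" "circular_arc_graph G"
  obtains p where "bij_betw p (verts G) {..<card (verts G)}"
    "\<And>u v. u \<rightarrow>\<^bsub>G\<^esub> v \<Longrightarrow>
      p v \<le> p u + max_degree G \<and> p u \<le> p v + max_degree G \<or>
      card (verts G) \<le> max_degree G + (p u - p v) \<or>
      card (verts G) \<le> max_degree G + (p v - p u)"
proof -
  interpret graph G by fact
  let ?n = "card (verts G)" and ?D = "max_degree G"
  obtain f where f: "\<And>v. v \<in> verts G \<Longrightarrow> is_closed_arc (f v)" "intersection_rep G f"
    using assms(2) by (auto simp: circular_arc_graph_def)
  have "\<forall>v\<in>verts G. \<exists>a b. 0 \<le> a \<and> a < 2 * pi \<and> a \<le> b \<and> f v = cis ` {a..b}"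
    using closed_arc_normalized[OF f(1)] by metis
  then obtain a b where ab: "\<And>v. v \<in> verts G \<Longrightarrow>
      0 \<le> a v \<and> a v < 2 * pi \<and> a v \<le> b v \<and> f v = cis ` {a v..b v}"
    by metis
  obtain p where p: "bij_betw p (verts G) {..<?n}"
    "\<And>u v. \<lbrakk>u \<in> verts G; v \<in> verts G; p u \<le> p v\<rbrakk> \<Longrightarrow> a u \<le> a v"
    using ex_monotone_enumeration[OF finite_verts, of a] by metis
  \<comment> \<open>Counting tool: if the arcs at all positions in \<open>I\<close> meet the arc of
    \<open>u\<close>, then \<open>I\<close> enumerates part of the closed neighbourhood of
    \<open>u\<close>.\<close>
  have count: "card I \<le> Suc ?D" if "u \<in> verts G" "I \<subseteq> {..<?n}"
    "\<And>w. w \<in> verts G \<Longrightarrow> p w \<in> I \<Longrightarrow> f u \<inter> f w \<noteq> {}" for u I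
  proof -
    have "card {w \<in> verts G. p w \<in> I} \<le> Suc ?D"
    proof (rule card_le_max_degree[OF assms(1) that(1)])
      fix w assume "w \<in> {w \<in> verts G. p w \<in> I}" "w \<noteq> u"
      then show "u \<rightarrow>\<^bsub>G\<^esub> w"
        using that f(2) by (auto simp: intersection_rep_def)
    qed
    moreover have "p ` {w \<in> verts G. p w \<in> I} = I"
      using p(1) that(2) by (auto simp: bij_betw_def)
    ultimately show ?thesis
      using card_image_le[of "{w \<in> verts G. p w \<in> I}" p] by simp
  qed
  have meets: "f u \<inter> f w \<noteq> {}" if "u \<in> verts G" "w \<in> verts G"
    "a w \<in> {a u..b u} \<or> a w + 2 * pi \<in> {a u..b u}" for u w
  proof -
    have "cis (a w + 2 * pi) = cis (a w)"
      by (simp add: complex_eq_iff)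
    then have "cis (a w) \<in> f u"
      using that ab[of u] by (metis imageI)
    moreover have "cis (a w) \<in> f w"
      using ab[of w] that by simp
    ultimately show ?thesis
      by blast
  qed
  have dist: "p v \<le> p u + ?D \<and> p u \<le> p v + ?D \<or> ?n \<le> ?D + (p u - p v)"
    if uv: "u \<in> verts G" "v \<in> verts G" "a v \<in> {a u..b u} \<or> a v + 2 * pi \<le> b u" for u v
    using uv(3)
  proof
    assume av: "a v \<in> {a u..b u}"
    \<comment> \<open>The order of \<open>p u\<close> and \<open>p v\<close> is open because equal
      starting points are sorted arbitrarily.\<close>
    have "card {min (p u) (p v)..max (p u) (p v)} \<le> Suc ?D"
    proof (rule count[OF uv(1)])
      show "{min (p u) (p v)..max (p u) (p v)} \<subseteq> {..<?n}"
        using bij_betwE[OF p(1)] uv(1,2) by (auto simp: max_def split: if_splits)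
      fix w assume w: "w \<in> verts G" "p w \<in> {min (p u) (p v)..max (p u) (p v)}"
      have "a w \<in> {a u..b u}"
      proof (cases "p u \<le> p v")
        case True
        then show ?thesis
          using w p(2)[of u w] p(2)[of w v] uv(1,2) av by auto
      next
        case False
        then show ?thesis
          using w p(2)[of v w] p(2)[of w u] uv(1,2) av by auto
      qed
      then show "f u \<inter> f w \<noteq> {}"
        using meets[OF uv(1) w(1)] by blast
    qed
    then show ?thesis
      by (auto simp: min_def max_def split: if_splits)
  next
    assume av: "a v + 2 * pi \<le> b u"
    have lt: "p u < ?n" "p v < ?n"
      using bij_betwE[OF p(1)] uv(1,2) by auto
    \<comment> \<open>The arc of \<open>u\<close> passes angle \<open>2 * pi\<close> and reaches the
      start of \<open>v\<close> a turn later. So it covers the starts from \<open>p u\<close> on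
      and, after wrapping, those up to \<open>p v\<close>.\<close>
    have "card ({..p v} \<union> {p u..<?n}) \<le> Suc ?D"
    proof (rule count[OF uv(1)])
      show "{..p v} \<union> {p u..<?n} \<subseteq> {..<?n}"
        using lt by auto
      fix w assume w: "w \<in> verts G" "p w \<in> {..p v} \<union> {p u..<?n}"
      have "a w \<le> a v \<or> a u \<le> a w"
        using w p(2)[of w v] p(2)[of u w] uv(1,2) by auto
      then have "a w \<in> {a u..b u} \<or> a w + 2 * pi \<in> {a u..b u}"
        using ab[of u] ab[of v] ab[of w] uv(1,2) w(1) av by auto
      then show "f u \<inter> f w \<noteq> {}"
        using meets[OF uv(1) w(1)] by blast
    qed
    moreover have "{..p v} \<union> {p u..<?n} = {..<?n}" if "p u \<le> p v"
      using that lt by auto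
    moreover have "card ({..p v} \<union> {p u..<?n}) = Suc (p v) + (?n - p u)" if "p v < p u"
      using that by (subst card_Un_disjoint) auto
    ultimately show ?thesis
      using lt by (cases "p u \<le> p v") auto
  qed
  show thesis
  proof (rule that[OF p(1)])
    fix u v assume adj: "u \<rightarrow>\<^bsub>G\<^esub> v"
    then have uv: "u \<in> verts G" "v \<in> verts G" "u \<noteq> v"
      by (auto dest: adj_not_same)
    then have "f u \<inter> f v \<noteq> {}"
      using adj f(2) by (auto simp: intersection_rep_def)
    then have "a v \<in> {a u..b u} \<or> a v + 2 * pi \<le> b u \<or> a u \<in> {a v..b v} \<or> a u + 2 * pi \<le> b v"
      using ab uv intersecting_arcs[of "a u" "a v" "b u" "b v"] by simp
    then show "p v \<le> p u + ?D \<and> p u \<le> p v + ?D \<or> ?n \<le> ?D + (p u - p v) \<or> ?n \<le> ?D + (p v - p u)"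
      using dist[of u v] dist[of v u] uv by blast
  qed
qed

theorem corollary1:
  fixes G :: "('a, 'b) pre_digraph"
  assumes "graph G" and "circular_arc_graph G"
  shows "cubicity G \<le> 2 * max_degree G + 1"
proof -
  interpret graph G by fact
  let ?n = "card (verts G)"
  obtain p where p: "bij_betw p (verts G) {..<?n}"
    and dist: "\<And>u v. u \<rightarrow>\<^bsub>G\<^esub> v \<Longrightarrow>
      p v \<le> p u + max_degree G \<and> p u \<le> p v + max_degree G \<or>
      ?n \<le> max_degree G + (p u - p v) \<or> ?n \<le> max_degree G + (p v - p u)"
    using circular_arc_cyclic_order[OF assms] by blast
  show ?thesis
  proof (rule cubicity_le_bandwidth[OF assms(1)])
    show "inj_on (fold_cycle ?n \<circ> p) (verts G)"
      using p inj_on_fold_cycle[of ?n] by (intro comp_inj_on) (auto simp: bij_betw_def)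
    fix u v assume adj: "u \<rightarrow>\<^bsub>G\<^esub> v"
    then have "p u < ?n" "p v < ?n"
      using bij_betwE[OF p] by auto
    then show "(fold_cycle ?n \<circ> p) v \<le> (fold_cycle ?n \<circ> p) u + 2 * max_degree G"
      using fold_cycle_le dist[OF adj] by simp
  qed
qed

end
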